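(* Let $I_2>I_1>I_3$. The change of angle $\tilde\phi_2$ in the rotor-on stage, from $\mathbf{L}=(l,0,0)$ to the highest point of the orbit, satisfies \[ \tilde\phi_2-\hat T_2=f_+\,\Pi(n_+,k^2)+f_-\,\Pi(n_-,k^2), \] where \[ k^2=\frac{(s_-^{-2}-1)\,(s_-^2(1-\nu)+\nu)}{(2-s_-^2)(1-\nu)},\qquad \nu=\frac{\delta}{\gamma},\qquad g=s_-\sqrt{(1-s_-^2)(2-s_-^2)(1-\nu)}, \] \[ n_\pm=1-s_-^{-2}\pm s_-^{-2}\sqrt{\frac{1-s_-^2}{1-\nu}},\qquad f_\pm=g\left(1-s_-^2\mp\sqrt{(1-s_-^2)(1-\nu)}\right). \]
   Context: A rigid body with principal moments of inertia $I_1,I_2,I_3$ carries a rotor which, when on, produces the constant internal angular momentum $(0,h,0)^t$ in the body frame. The total angular momentum is constant in space, equal to $(l,0,0)^t$. Put $\delta=I_1/I_2-1$, $\gamma=I_1/I_3-1$, $\rho=h/l$, $\hat\rho=\rho(1+\delta)$; the dimensionless time is $\tau=tl/I_1$ (prime denotes $d/d\tau$). The rotation from the body frame to the space frame is $R=R_1(\tilde\phi)R_3(\tilde\theta)R_2(\tilde\psi)$, where $R_i$ is a rotation fixing the $i$th axis, so that the body-frame angular momentum is $\mathbf{L}=l(\cos\tilde\theta\cos\tilde\psi,-\sin\tilde\theta,\cos\tilde\theta\sin\tilde\psi)$. The scaled equations of motion with rotor on are $\tilde\phi'=1+\gamma\sin^2\tilde\psi$, $\tilde\theta'=\gamma\cos\tilde\theta\sin\tilde\psi\cos\tilde\psi$,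 $\tilde\psi'=-(1+\delta)\rho+\sin\tilde\theta(\gamma\sin^2\tilde\psi-\delta)$. The tilt angle $\theta$ is defined by the third component of $\mathbf{L}$ being $l\sin\theta$. The rotor-on stage is the motion along the orbit segment from $(l,0,0)$ to the highest point $l(0,-\sin\tilde\theta_{max},\cos\tilde\theta_{max})$ of that orbit, where the tilt takes its maximal value $\theta_{max}$ and $-\cos\theta_{max}=\sin\tilde\theta_{max}=\frac{\hat\rho-\sqrt{\hat\rho^2+\gamma(\gamma-\delta)}}{\gamma-\delta}$. $\hat T_2=lT_2/I_1$ is the scaled duration of this stage and $\tilde\phi_2$ the change of $\tilde\phi$ during it. With $s_+=\sin\theta_{max}$, $s_-=\sin\theta_{min}$ is the sine of the minimal tilt in the subsequent rotor-off twisting motion, whose maximal tilt is $\theta_{max}$; they are related by $s_+^2+(1-s_+^2)\nu=s_-^2$. $\Pi(n,k^2)=\int_0^{\pi/2}\frac{d\alpha}{(1-n\sin^2\alpha)\sqrt{1-k^2\sin^2\alpha}}$ is the complete elliptic integral of the third kind.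
   Formalization: The printed g is replaced by its reciprocal, since the identity is false with the printed g; the highest point is taken as the first maximum of the unsigned tilt, because for h>0 the orbit first reaches its mirror image with negative third component; h is nonzero. *)

theory Defs
  imports "HOL-Analysis.Analysis"
begin

(* Scaled equations of motion for the angles (phi, theta, psi) of
   R = R_1(phi) R_3(theta) R_2(psi); the rotor-off equations are those with rho = 0. *)
definition scaled_motion ::
  "real \<Rightarrow> real \<Rightarrow> real \<Rightarrow> (real \<Rightarrow> real) \<Rightarrow> (real \<Rightarrow> real) \<Rightarrow> (real \<Rightarrow> real) \<Rightarrow> bool"
where
  "scaled_motion \<delta> \<gamma> \<rho> \<phi> \<theta> \<psi> \<longleftrightarrow>
     (\<forall>\<tau>. (\<phi> has_real_derivative 1 + \<gamma> * (sin (\<psi> \<tau>))\<^sup>2) (at \<tau>) \<and>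
          (\<theta> has_real_derivative \<gamma> * cos (\<theta> \<tau>) * sin (\<psi> \<tau>) * cos (\<psi> \<tau>)) (at \<tau>) \<and>
          (\<psi> has_real_derivative
             - (1 + \<delta>) * \<rho> + sin (\<theta> \<tau>) * (\<gamma> * (sin (\<psi> \<tau>))\<^sup>2 - \<delta>)) (at \<tau>))"

definition body_ang_mom :: "real \<Rightarrow> real \<Rightarrow> real \<Rightarrow> real ^ 3" where
  "body_ang_mom l \<theta> \<psi> = vector [l * cos \<theta> * cos \<psi>, - l * sin \<theta>, l * cos \<theta> * sin \<psi>]"

(* Unsigned tilt: the third component of the angular momentum is \<plusminus> l sin (tilt).
   Only the magnitude is used because the orbit is symmetric under L_3 \<mapsto> - L_3, and it depends on
   the sign of h whether the motion leaving (l,0,0) first reaches the extreme point with L_3 > 0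
   (when h < 0) or its mirror image with L_3 < 0 (when h > 0). *)
definition tilt :: "real \<Rightarrow> real \<Rightarrow> real \<Rightarrow> real" where
  "tilt l \<theta> \<psi> = \<bar>arcsin (body_ang_mom l \<theta> \<psi> $ 3 / l)\<bar>"

(* Complete elliptic integral of the third kind. The second argument is the parameter m = k^2,
   not the modulus k; m may be negative. *)
definition ellipticPi :: "real \<Rightarrow> real \<Rightarrow> real" where
  "ellipticPi n m =
     integral {0..pi/2} (\<lambda>\<alpha>. 1 / ((1 - n * (sin \<alpha>)\<^sup>2) * sqrt (1 - m * (sin \<alpha>)\<^sup>2)))"

end

theory Submission
  imports Defs
begin

text \<open>
  Write \<open>(x, y, z)\<close> for the body-frame angular momentum divided by \<open>l\<close>; it moves on the unit
  sphere. Two observations turn the precession angle into elliptic integrals.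

  First, each stage has an energy that is quadratic in \<open>y\<close> and \<open>z\<close>. With the rotor on, an orbit
  starting at \<open>(1, 0, 0)\<close> keeps \<open>\<gamma> z\<^sup>2 + \<delta> y\<^sup>2\<close> equal to a multiple of \<open>y\<close>, so \<open>x\<^sup>2\<close> and \<open>z\<^sup>2\<close> are
  quadratic polynomials in \<open>u = \<bar>y\<bar>\<close>, and \<open>u\<close> grows monotonically from \<open>0\<close> to the value \<open>a\<close> at which
  \<open>x\<close> vanishes and the tilt is maximal (lemma \<open>rotor_on_segment\<close>). With the rotor off,
  \<open>z\<^sup>2 + \<nu> y\<^sup>2\<close> is constant, and since \<open>\<nu> < 0\<close> the tilt is minimal where \<open>y = 0\<close> (lemma
  \<open>twisting_min\<close>). Hence \<open>s\<^sup>2 = 1 - (1 - \<nu>) a\<^sup>2\<close>, and \<open>a\<close> and \<open>\<nu>\<close> determine every constant in the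
  formula.

  Second, the time differential on the segment is \<open>du / (\<gamma> \<bar>x z\<bar>)\<close>, and \<open>x\<^sup>2 z\<^sup>2\<close> is a quartic in \<open>u\<close>
  whose roots are \<open>0\<close>, \<open>a\<close> and two negative numbers, one from each factor. The Moebius map
  \<open>t = (a - u) / (a + \<kappa> u)\<close> sends \<open>a\<close> to \<open>0\<close>, \<open>0\<close> to \<open>1\<close>, the negative root of \<open>z\<^sup>2\<close> to infinity and that
  of \<open>x\<^sup>2\<close> to \<open>1/k\<^sup>2\<close>. In the angle \<open>\<alpha>\<close> with \<open>sin\<^sup>2 \<alpha> = t\<close> the motion is therefore
  \<open>\<alpha>' = - \<omega> sqrt (1 - k\<^sup>2 sin\<^sup>2 \<alpha>)\<close> with constant \<open>\<omega>\<close> (lemma \<open>amplitude_deriv\<close>), and \<open>\<alpha>\<close> falls from \<open>\<pi>/2\<close>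
  to \<open>0\<close> during the stage. The excess precession rate is \<open>\<gamma> sin\<^sup>2 \<psi> = \<gamma> z\<^sup>2 / (1 - y\<^sup>2)\<close>. As a function of
  \<open>t\<close> it is rational, has simple poles at the images \<open>1/n\<^sub>+\<close> and \<open>1/n\<^sub>-\<close> of \<open>u = -1\<close> and \<open>u = 1\<close>, and vanishes
  at infinity; its partial fractions are the two integrands of the third kind (lemma
  \<open>precession_partial_fractions\<close>). Integrating along the segment gives the theorem (lemma
  \<open>elliptic_quadrature\<close>).
\<close>

section \<open>Quadrature by complete elliptic integrals of the third kind\<close>

lemma elliptic_radicand_pos:
  fixes k :: real
  assumes "k < 1"
  shows "0 < 1 - k * (sin \<alpha>)\<^sup>2"
proof -
  have "(sin \<alpha>)\<^sup>2 \<le> 1" "0 \<le> (sin \<alpha>)\<^sup>2" by (simp_all add: abs_square_le_1)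
  then show ?thesis
    using assms mult_nonpos_nonneg[of k "(sin \<alpha>)\<^sup>2"] mult_left_le[of "(sin \<alpha>)\<^sup>2" k]
    by (cases "k \<le> 0") linarith+
qed

text \<open>
  Separation of variables: if \<open>G\<close> is the primitive of the elliptic integrand with \<open>G 0 = 0\<close>, then
  \<open>\<Phi> + G \<circ> \<alpha>\<close> is constant, because the factor \<open>- \<omega> sqrt (1 - k sin\<^sup>2 \<alpha>)\<close> turns the integrand into
  \<open>- \<Phi>'\<close>. Derivatives are asked for only in the open interval, since an amplitude of the form
  \<open>arcsin (sqrt t)\<close> meets the singular points of \<open>arcsin\<close> and \<open>sqrt\<close> at the ends.
\<close>

lemma elliptic_quadrature:
  fixes \<alpha> \<Phi> :: "real \<Rightarrow> real"
  assumes T: "0 < T" and lt1: "p < 1" "q < 1" "k < 1"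
    and cont: "continuous_on {0..T} \<alpha>" "continuous_on {0..T} \<Phi>"
    and ends: "\<alpha> 0 = pi / 2" "\<alpha> T = 0"
    and range: "\<And>\<tau>. 0 < \<tau> \<Longrightarrow> \<tau> < T \<Longrightarrow> 0 < \<alpha> \<tau> \<and> \<alpha> \<tau> < pi / 2"
    and d\<alpha>: "\<And>\<tau>. 0 < \<tau> \<Longrightarrow> \<tau> < T \<Longrightarrow>
       (\<alpha> has_real_derivative - \<omega> * sqrt (1 - k * (sin (\<alpha> \<tau>))\<^sup>2)) (at \<tau>)"
    and d\<Phi>: "\<And>\<tau>. 0 < \<tau> \<Longrightarrow> \<tau> < T \<Longrightarrow> (\<Phi> has_real_derivative
       \<omega> * (A / (1 - p * (sin (\<alpha> \<tau>))\<^sup>2) + B / (1 - q * (sin (\<alpha> \<tau>))\<^sup>2))) (at \<tau>)"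
  shows "\<Phi> T - \<Phi> 0 = A * ellipticPi p k + B * ellipticPi q k"
proof -
  define e where "e n \<beta> = 1 / ((1 - n * (sin \<beta>)\<^sup>2) * sqrt (1 - k * (sin \<beta>)\<^sup>2))" for n \<beta> :: real
  define F where "F \<beta> = A * e p \<beta> + B * e q \<beta>" for \<beta>
  define G where "G \<beta> = integral {0..\<beta>} F" for \<beta>
  have conte: "continuous_on S (e n)" if "n < 1" for n and S :: "real set"
    unfolding e_def
    by (intro continuous_intros) (use elliptic_radicand_pos that lt1 in \<open>auto simp: less_le\<close>)
  have inte: "e n integrable_on {0..pi/2}" if "n < 1" for n
    by (rule integrable_continuous_real[OF conte[OF that]])
  have contF: "continuous_on {0..pi/2} F"
    unfolding F_def by (intro continuous_intros conte lt1)
  have G_end: "G (pi/2) = A * ellipticPi p k + B * ellipticPi q k"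
    unfolding G_def F_def ellipticPi_def e_def[symmetric]
    using inte lt1 by (subst integral_add) (auto intro!: integrable_on_mult_right)
  have contG: "continuous_on {0..pi/2} G"
    unfolding G_def
    by (rule indefinite_integral_continuous_1) (rule integrable_continuous_real[OF contF])
  have dG: "(G has_real_derivative F \<beta>) (at \<beta>)" if "0 < \<beta>" "\<beta> < pi/2" for \<beta>
  proof -
    have "(G has_real_derivative F \<beta>) (at \<beta> within {0..pi/2})"
      unfolding G_def by (rule integral_has_real_derivative[OF contF]) (use that in auto)
    then show ?thesis
      using that at_within_Icc_at[of 0 \<beta> "pi/2"] by simp
  qed
  have range': "\<alpha> ` {0..T} \<subseteq> {0..pi/2}"
  proof (clarsimp)
    fix \<tau> assume "0 \<le> \<tau>" "\<tau> \<le> T"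
    then consider "\<tau> = 0" | "\<tau> = T" | "0 < \<tau>" "\<tau> < T" by linarith
    then show "0 \<le> \<alpha> \<tau> \<and> \<alpha> \<tau> * 2 \<le> pi"
      using range[of \<tau>] ends pi_gt_zero by cases (auto simp del: pi_gt_zero)
  qed
  define H where "H \<tau> = \<Phi> \<tau> + G (\<alpha> \<tau>)" for \<tau>
  have "H T = H 0"
  proof (rule DERIV_isconst_end[OF T])
    show "continuous_on {0..T} H"
      unfolding H_def
      by (intro continuous_on_add cont continuous_on_compose2[OF contG cont(1) range'])
  next
    fix \<tau> assume \<tau>: "0 < \<tau>" "\<tau> < T"
    have r: "sqrt (1 - k * (sin (\<alpha> \<tau>))\<^sup>2) \<noteq> 0"
      using elliptic_radicand_pos[OF lt1(3), of "\<alpha> \<tau>"] by simp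
    have "((\<lambda>\<tau>. G (\<alpha> \<tau>)) has_real_derivative
        F (\<alpha> \<tau>) * (- \<omega> * sqrt (1 - k * (sin (\<alpha> \<tau>))\<^sup>2))) (at \<tau>)"
      using range[OF \<tau>] by (intro DERIV_chain2[OF dG d\<alpha>[OF \<tau>]]) auto
    from DERIV_add[OF d\<Phi>[OF \<tau>] this]
    show "(H has_real_derivative 0) (at \<tau>)"
      unfolding H_def[abs_def]
    proof (rule DERIV_cong)
      define \<Delta> where "\<Delta> = sqrt (1 - k * (sin (\<alpha> \<tau>))\<^sup>2)"
      have "e n (\<alpha> \<tau>) * \<Delta> = 1 / (1 - n * (sin (\<alpha> \<tau>))\<^sup>2)" for n
        unfolding e_def \<Delta>_def using r by simp
      then have "F (\<alpha> \<tau>) * \<Delta> = A / (1 - p * (sin (\<alpha> \<tau>))\<^sup>2) + B / (1 - q * (sin (\<alpha> \<tau>))\<^sup>2)"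
        unfolding F_def by (simp add: distrib_right mult.assoc)
      from this[symmetric]
      show "\<omega> * (A / (1 - p * (sin (\<alpha> \<tau>))\<^sup>2) + B / (1 - q * (sin (\<alpha> \<tau>))\<^sup>2)) +
          F (\<alpha> \<tau>) * (- \<omega> * sqrt (1 - k * (sin (\<alpha> \<tau>))\<^sup>2)) = 0"
        unfolding \<Delta>_def[symmetric] by simp
    qed
  qed
  then show ?thesis
    using ends G_end by (simp add: H_def G_def)
qed

section \<open>The angular momentum along a motion\<close>

text \<open>
  Euler's equations for the momentum divided by \<open>l\<close>. In these components the right-hand sides are
  polynomial, which makes the quadratic integrals of the motion visible.
\<close>

lemma ang_mom_deriv:
  assumes "scaled_motion \<delta> \<gamma> \<rho> \<phi> \<theta> \<psi>"
  shows "((\<lambda>\<tau>. cos (\<theta> \<tau>) * cos (\<psi> \<tau>)) has_real_derivative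
      cos (\<theta> \<tau>) * sin (\<psi> \<tau>) * ((1 + \<delta>) * \<rho> + (\<gamma> - \<delta>) * - sin (\<theta> \<tau>))) (at \<tau>)" (is ?X)
    and "((\<lambda>\<tau>. - sin (\<theta> \<tau>)) has_real_derivative
      - \<gamma> * (cos (\<theta> \<tau>) * cos (\<psi> \<tau>)) * (cos (\<theta> \<tau>) * sin (\<psi> \<tau>))) (at \<tau>)" (is ?Y)
    and "((\<lambda>\<tau>. cos (\<theta> \<tau>) * sin (\<psi> \<tau>)) has_real_derivative
      cos (\<theta> \<tau>) * cos (\<psi> \<tau>) * (- (1 + \<delta>) * \<rho> + \<delta> * - sin (\<theta> \<tau>))) (at \<tau>)" (is ?Z)
proof -
  have d: "(\<theta> has_real_derivative \<gamma> * cos (\<theta> \<tau>) * sin (\<psi> \<tau>) * cos (\<psi> \<tau>)) (at \<tau>)"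
     "(\<psi> has_real_derivative
             - (1 + \<delta>) * \<rho> + sin (\<theta> \<tau>) * (\<gamma> * (sin (\<psi> \<tau>))\<^sup>2 - \<delta>)) (at \<tau>)"
    using assms by (auto simp: scaled_motion_def)
  have sc: "(cos (\<psi> \<tau>))\<^sup>2 = 1 - (sin (\<psi> \<tau>))\<^sup>2" by (simp add: cos_squared_eq)
  show ?X
    apply (rule DERIV_cong)
     apply (rule derivative_eq_intros d refl)+
    using sc by algebra
  show ?Y
    apply (rule DERIV_cong)
     apply (rule derivative_eq_intros d refl)+
    by algebra
  show ?Z
    apply (rule DERIV_cong)
     apply (rule derivative_eq_intros d refl)+
    apply (simp add: algebra_simps power2_eq_square)
    done
qed

lemma ang_mom_unit:
  "(cos \<theta> * cos \<psi>)\<^sup>2 + (sin \<theta>)\<^sup>2 + (cos \<theta> * sin \<psi>)\<^sup>2 = (1::real)"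
proof -
  have "(sin \<theta>)\<^sup>2 + (cos \<theta>)\<^sup>2 = 1" "(sin \<psi>)\<^sup>2 + (cos \<psi>)\<^sup>2 = 1" by simp_all
  then show ?thesis by algebra
qed

lemma sin_tilt:
  assumes "0 < l"
  shows "sin (tilt l \<theta> \<psi>) = \<bar>cos \<theta> * sin \<psi>\<bar>"
    and "0 \<le> tilt l \<theta> \<psi>" "tilt l \<theta> \<psi> \<le> pi / 2"
proof -
  have b: "\<bar>cos \<theta> * sin \<psi>\<bar> \<le> 1"
    by (simp add: abs_mult mult_le_one)
  have "tilt l \<theta> \<psi> = \<bar>arcsin (cos \<theta> * sin \<psi>)\<bar>"
    using assms by (simp add: tilt_def body_ang_mom_def)
  also have "\<dots> = arcsin \<bar>cos \<theta> * sin \<psi>\<bar>"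
    using b arcsin_minus[of "cos \<theta> * sin \<psi>"] arcsin_le_arcsin[of 0 "\<bar>cos \<theta> * sin \<psi>\<bar>"]
    by (auto simp: abs_if split: if_splits)
  finally have t: "tilt l \<theta> \<psi> = arcsin \<bar>cos \<theta> * sin \<psi>\<bar>" .
  show "sin (tilt l \<theta> \<psi>) = \<bar>cos \<theta> * sin \<psi>\<bar>"
    unfolding t by (rule sin_arcsin) (use b in auto)
  show "0 \<le> tilt l \<theta> \<psi>" by (simp add: tilt_def)
  show "tilt l \<theta> \<psi> \<le> pi / 2"
    unfolding t by (rule arcsin_ubound) (use b in auto)
qed

text \<open>
  Extremal tilt can be read off from the square of the third component, which, unlike the tilt
  itself, is a smooth function of time.
\<close>

lemma tilt_mono_iff:
  assumes "0 < l"
  shows "tilt l \<theta> \<psi> \<le> tilt l \<theta>' \<psi>' \<longleftrightarrow> (cos \<theta> * sin \<psi>)\<^sup>2 \<le> (cos \<theta>' * sin \<psi>')\<^sup>2"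
proof -
  note t = sin_tilt[OF assms, of \<theta> \<psi>] and t' = sin_tilt[OF assms, of \<theta>' \<psi>']
  have "tilt l \<theta> \<psi> \<le> tilt l \<theta>' \<psi>' \<longleftrightarrow> sin (tilt l \<theta> \<psi>) \<le> sin (tilt l \<theta>' \<psi>')"
    using t t' by (subst sin_mono_le_eq) auto
  then show ?thesis
    using t t' by (simp add: abs_le_square_iff)
qed

section \<open>The rotor-on segment\<close>

text \<open>
  In this section \<open>u\<close> and \<open>w\<close> are the second and third component of the scaled momentum with signs
  chosen so that both are nonnegative on the segment, and \<open>r = (1 + \<delta>) \<bar>\<rho>\<bar>\<close>. The first lemma is
  conservation of energy on the orbit through \<open>(1, 0, 0)\<close>.
\<close>

lemma rotor_on_energy:
  fixes x u w :: "real \<Rightarrow> real"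
  assumes du: "\<And>\<tau>. (u has_real_derivative \<gamma> * x \<tau> * w \<tau>) (at \<tau>)"
    and dw: "\<And>\<tau>. (w has_real_derivative x \<tau> * (r - \<delta> * u \<tau>)) (at \<tau>)"
    and start: "u 0 = 0" "w 0 = 0"
  shows "\<gamma> * (w \<tau>)\<^sup>2 = u \<tau> * (2 * r - \<delta> * u \<tau>)"
proof -
  define E where "E \<tau> = \<gamma> * (w \<tau>)\<^sup>2 - u \<tau> * (2 * r - \<delta> * u \<tau>)" for \<tau>
  have "(E has_real_derivative 0) (at \<tau>)" for \<tau>
    unfolding E_def
    apply (rule DERIV_cong)
     apply (rule derivative_eq_intros du dw refl)+
    apply (simp add: algebra_simps)
    done
  then have "E \<tau> = E 0"
    by (intro DERIV_isconst_all) auto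
  then show ?thesis using start by (simp add: E_def)
qed

text \<open>
  The energy forbids \<open>u\<close> to lie strictly between \<open>2 r / \<delta>\<close> and \<open>0\<close>, so an orbit starting at \<open>u = 0\<close>
  keeps \<open>u \<ge> 0\<close> and the factor \<open>r - \<delta> u\<close> in \<open>w'\<close> stays positive. At the maximum of \<open>w\<^sup>2\<close>, where
  \<open>w w' = 0\<close>, this leaves only \<open>x = 0\<close>. As \<open>x = 0\<close> determines \<open>u\<close>, and with it \<open>w\<^sup>2\<close>, the first maximum
  is also the first zero of \<open>x\<close>; before it \<open>w\<close> increases.
\<close>

lemma rotor_on_segment:
  fixes x u w :: "real \<Rightarrow> real"
  assumes pos: "0 < \<gamma>" "\<delta> < 0" "0 < r" "0 < T"
    and dx: "\<And>\<tau>. (x has_real_derivative - w \<tau> * (r + (\<gamma> - \<delta>) * u \<tau>)) (at \<tau>)"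
    and du: "\<And>\<tau>. (u has_real_derivative \<gamma> * x \<tau> * w \<tau>) (at \<tau>)"
    and dw: "\<And>\<tau>. (w has_real_derivative x \<tau> * (r - \<delta> * u \<tau>)) (at \<tau>)"
    and sphere: "\<And>\<tau>. (x \<tau>)\<^sup>2 + (u \<tau>)\<^sup>2 + (w \<tau>)\<^sup>2 = 1"
    and start: "x 0 = 1" "u 0 = 0" "w 0 = 0"
    and max: "\<And>\<tau>. (w \<tau>)\<^sup>2 \<le> (w T)\<^sup>2"
    and first: "\<And>\<tau>. 0 \<le> \<tau> \<Longrightarrow> \<tau> < T \<Longrightarrow> (w \<tau>)\<^sup>2 < (w T)\<^sup>2"
  shows "x T = 0"
    and "\<And>\<tau>. 0 \<le> \<tau> \<Longrightarrow> \<tau> < T \<Longrightarrow> 0 < x \<tau>"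
    and "\<And>\<tau>. 0 < \<tau> \<Longrightarrow> \<tau> \<le> T \<Longrightarrow> 0 < w \<tau>"
    and "\<And>\<tau>. 0 < \<tau> \<Longrightarrow> \<tau> \<le> T \<Longrightarrow> 0 < u \<tau>"
proof -
  note en = rotor_on_energy[of u \<gamma> x w r \<delta>, OF du dw start(2,3)]
  have cont: "continuous_on S x" "continuous_on S u" "continuous_on S w" for S
    using dx du dw by (meson DERIV_isCont continuous_at_imp_continuous_on)+
  have u_nonneg: "0 \<le> u \<tau>" if "0 \<le> \<tau>" for \<tau>
  proof (rule ccontr)
    assume "\<not> 0 \<le> u \<tau>"
    then have neg: "u \<tau> < 0" by simp
    have "0 \<le> u \<tau> * (2 * r - \<delta> * u \<tau>)" using en[of \<tau>] pos by (metis less_imp_le mult_nonneg_nonneg zero_le_power2)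
    with neg have "2 * r - \<delta> * u \<tau> \<le> 0" by (simp add: zero_le_mult_iff)
    then have "u \<tau> \<le> 2 * r / \<delta>" using pos by (simp add: field_simps)
    also have "\<dots> \<le> r / \<delta>" using pos by (simp add: field_simps)
    \<comment> \<open>the midpoint of the forbidden interval would have to be crossed\<close>
    finally have le: "u \<tau> \<le> r / \<delta>" .
    have "r / \<delta> \<le> u 0" using pos start by (simp add: divide_nonneg_neg)
    from IVT2'[OF le this that cont(2)] obtain \<tau>' where "u \<tau>' = r / \<delta>" by blast
    then have "\<gamma> * (w \<tau>')\<^sup>2 = r / \<delta> * r" using en[of \<tau>'] pos by simp
    moreover have "r / \<delta> * r < 0" using pos by (simp add: mult_neg_pos divide_pos_neg)
    ultimately show False using pos by (metis less_imp_le mult_nonneg_nonneg not_le zero_le_power2)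
  qed
  have slope: "0 < r - \<delta> * u \<tau>" if "0 \<le> \<tau>" for \<tau>
    using mult_nonpos_nonneg[OF less_imp_le[OF pos(2)] u_nonneg[OF that]] pos by linarith
  have wT: "w T \<noteq> 0" using first[of 0] start pos by auto
  show xT: "x T = 0"
  proof -
    have "((\<lambda>\<tau>. (w \<tau>)\<^sup>2) has_real_derivative 2 * w T * (x T * (r - \<delta> * u T))) (at T)"
      apply (rule DERIV_cong)
       apply (rule derivative_eq_intros dw refl)+
      by simp
    from DERIV_local_max[OF this, of 1] max have "2 * w T * (x T * (r - \<delta> * u T)) = 0" by simp
    then show ?thesis using wT slope[of T] pos by auto
  qed
  show x_pos: "0 < x \<tau>" if \<tau>: "0 \<le> \<tau>" "\<tau> < T" for \<tau>
  proof (rule ccontr)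
    assume "\<not> 0 < x \<tau>"
    then obtain \<tau>' where t': "0 \<le> \<tau>'" "\<tau>' \<le> \<tau>" "x \<tau>' = 0"
      using IVT2'[of x \<tau> 0 0] \<tau> start cont(1) by auto
    \<comment> \<open>this quadratic in \<open>u\<close> is strictly increasing for \<open>u \<ge> 0\<close>, so it has one root there\<close>
    have q: "(\<gamma> - \<delta>) * (u v)\<^sup>2 + 2 * r * u v = \<gamma>" if "x v = 0" for v
      using sphere[of v] en[of v] that by (simp add: power2_eq_square algebra_simps) algebra
    have "(u T - u \<tau>') * ((\<gamma> - \<delta>) * (u T + u \<tau>') + 2 * r)
      = ((\<gamma> - \<delta>) * (u T)\<^sup>2 + 2 * r * u T) - ((\<gamma> - \<delta>) * (u \<tau>')\<^sup>2 + 2 * r * u \<tau>')"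
      by algebra
    then have "(u T - u \<tau>') * ((\<gamma> - \<delta>) * (u T + u \<tau>') + 2 * r) = 0"
      unfolding q[OF xT] q[OF t'(3)] by simp
    moreover have "0 < (\<gamma> - \<delta>) * (u T + u \<tau>') + 2 * r"
      using pos u_nonneg[of T] u_nonneg[of \<tau>'] t' by (intro add_nonneg_pos mult_nonneg_nonneg) auto
    ultimately have "u T = u \<tau>'" by simp
    then have "(w \<tau>')\<^sup>2 = (w T)\<^sup>2"
      using sphere[of \<tau>'] sphere[of T] xT t' by simp
    then show False using first[of \<tau>'] t' \<tau> by simp
  qed
  show w_pos: "0 < w \<tau>" if \<tau>: "0 < \<tau>" "\<tau> \<le> T" for \<tau>
  proof -
    have "w 0 < w \<tau>"
    proof (rule DERIV_pos_imp_increasing_open[OF \<tau>(1)])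
      fix v assume "0 < v" "v < \<tau>"
      then have "0 < x v * (r - \<delta> * u v)" using x_pos[of v] slope[of v] \<tau> by simp
      with dw[of v] show "\<exists>y. (w has_real_derivative y) (at v) \<and> 0 < y" by blast
    qed (use cont in auto)
    then show ?thesis using start by simp
  qed
  show "0 < u \<tau>" if \<tau>: "0 < \<tau>" "\<tau> \<le> T" for \<tau>
    using w_pos[OF \<tau>] u_nonneg[of \<tau>] en[of \<tau>] \<tau> pos by (cases "u \<tau> = 0") auto
qed

section \<open>The minimal tilt of the twisting motion\<close>

text \<open>
  At a minimum of \<open>z\<^sup>2\<close> after \<open>T\<close> the derivative \<open>2 \<delta> x y z\<close> vanishes. The energy keeps \<open>z\<close> away from \<open>0\<close>.
  If \<open>x\<close> vanished, the minimal and the maximal tilt of the orbit would agree, so \<open>x\<close> would be zero for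
  all times after \<open>T\<close>, although \<open>x' \<noteq> 0\<close> at \<open>T\<close>. Hence \<open>y = 0\<close>, and the energy equation there is the
  relation between the extremal tilts.
\<close>

lemma twisting_min:
  fixes x y z :: "real \<Rightarrow> real"
  assumes pos: "0 < \<gamma>" "\<delta> < 0"
    and dx: "\<And>\<tau>. (x has_real_derivative (\<gamma> - \<delta>) * y \<tau> * z \<tau>) (at \<tau>)"
    and dy: "\<And>\<tau>. (y has_real_derivative - \<gamma> * x \<tau> * z \<tau>) (at \<tau>)"
    and dz: "\<And>\<tau>. (z has_real_derivative \<delta> * x \<tau> * y \<tau>) (at \<tau>)"
    and sphere: "\<And>\<tau>. (x \<tau>)\<^sup>2 + (y \<tau>)\<^sup>2 + (z \<tau>)\<^sup>2 = 1"
    and top: "x T = 0" "y T \<noteq> 0" "0 < \<gamma> * (z T)\<^sup>2 + \<delta> * (y T)\<^sup>2"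
    and \<tau>0: "T \<le> \<tau>0" and min: "\<And>\<tau>. T \<le> \<tau> \<Longrightarrow> (z \<tau>0)\<^sup>2 \<le> (z \<tau>)\<^sup>2"
  shows "\<gamma> * (z \<tau>0)\<^sup>2 = \<gamma> * (z T)\<^sup>2 + \<delta> * (y T)\<^sup>2"
proof -
  define E where "E \<tau> = \<gamma> * (z \<tau>)\<^sup>2 + \<delta> * (y \<tau>)\<^sup>2" for \<tau>
  have "(E has_real_derivative 0) (at \<tau>)" for \<tau>
    unfolding E_def
    apply (rule DERIV_cong)
     apply (rule derivative_eq_intros dy dz refl)+
    apply (simp add: algebra_simps)
    done
  then have E: "E \<tau> = E T" for \<tau>
    by (intro DERIV_isconst_all) auto
  have z_nz: "z \<tau> \<noteq> 0" for \<tau>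
  proof
    assume "z \<tau> = 0"
    moreover have "\<delta> * (y \<tau>)\<^sup>2 \<le> 0" using pos by (simp add: mult_nonpos_nonneg)
    ultimately show False using E[of \<tau>] top by (simp add: E_def)
  qed
  have x_nz: "x \<tau>0 \<noteq> 0"
  proof
    assume x0: "x \<tau>0 = 0"
    \<comment> \<open>so \<open>x\<^sup>2 \<ge> 0\<close> makes \<open>y\<^sup>2\<close>, and hence \<open>z\<^sup>2\<close>, maximal at \<open>T\<close>\<close>
    have level: "\<gamma> * (x \<tau>)\<^sup>2 = (\<gamma> - \<delta>) * ((y T)\<^sup>2 - (y \<tau>)\<^sup>2)" for \<tau>
      using sphere[of \<tau>] sphere[of T] E[of \<tau>] top(1) unfolding E_def by algebra
    have x_zero: "x \<tau> = 0" if "T \<le> \<tau>" for \<tau>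
    proof -
      have e0: "(y \<tau>0)\<^sup>2 = (y T)\<^sup>2" using level[of \<tau>0] x0 pos by simp
      have "\<gamma> * (z \<tau>0)\<^sup>2 \<le> \<gamma> * (z \<tau>)\<^sup>2" using min[OF that] pos by simp
      then have "- \<delta> * (y \<tau>0)\<^sup>2 \<le> - \<delta> * (y \<tau>)\<^sup>2"
        using E[of \<tau>] E[of \<tau>0] unfolding E_def by linarith
      then have "(y T)\<^sup>2 \<le> (y \<tau>)\<^sup>2" using pos e0 by simp
      then have "\<gamma> * (x \<tau>)\<^sup>2 \<le> 0"
        unfolding level using pos by (simp add: mult_nonneg_nonpos)
      then show ?thesis using pos by (simp add: mult_le_0_iff)
    qed
    have "(x has_real_derivative (\<gamma> - \<delta>) * y T * z T) (at T within {T..})"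
      using dx by (rule has_field_derivative_at_within)
    moreover have "(x has_real_derivative 0) (at T within {T..})"
      by (rule has_field_derivative_transform_within[of "\<lambda>_. 0" _ _ _ 1]) (auto simp: x_zero)
    moreover have "at T within {T..} \<noteq> bot"
      by (simp add: at_within_Ici_at_right)
    ultimately have "(\<gamma> - \<delta>) * y T * z T = 0"
      using has_field_derivative_unique by blast
    then show False using top z_nz pos by auto
  qed
  then have "T < \<tau>0" using \<tau>0 top by (metis order_le_less)
  have "((\<lambda>\<tau>. (z \<tau>)\<^sup>2) has_real_derivative 2 * z \<tau>0 * (\<delta> * x \<tau>0 * y \<tau>0)) (at \<tau>0)"
    apply (rule DERIV_cong)
     apply (rule derivative_eq_intros dz refl)+
    by simp
  from DERIV_local_min[OF this, of "\<tau>0 - T"] \<open>T < \<tau>0\<close> min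
  have "2 * z \<tau>0 * (\<delta> * x \<tau>0 * y \<tau>0) = 0" by auto
  then have "y \<tau>0 = 0" using x_nz z_nz pos by auto
  then show ?thesis using E[of \<tau>0] by (simp add: E_def)
qed

section \<open>Uniformisation of the rotor-on segment\<close>

text \<open>
  Throughout, \<open>m = - \<nu>\<close>, \<open>S\<close> is the square of the sine of the minimal tilt and \<open>a\<close> is the value of \<open>u\<close>
  at maximal tilt. The right-hand side shows why this \<open>k\<close> is the right parameter: as a function of \<open>u\<close>,
  \<open>1 - k t\<close> vanishes at \<open>u = - 1 / ((1 + m) a)\<close>, the negative root of \<open>x\<^sup>2\<close>. At \<open>u = 0\<close>, where
  \<open>t = 1\<close>, the identity gives \<open>1 - k\<close>, from which \<open>k < 1\<close> follows for \<open>a < 1\<close>.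
\<close>

lemma one_minus_k_amplitude:
  fixes a m S u :: real
  assumes pos: "0 < a" "0 < m" "0 < S" "0 \<le> u"
    and S: "S = 1 - (1 + m) * a\<^sup>2"
    and \<kappa>: "\<kappa> = m * a\<^sup>2 / S"
    and k: "k = a\<^sup>2 * ((1 + m) * S - m) / (S * (2 - S))"
  shows "1 - k * ((a - u) / (a + \<kappa> * u))
    = (1 - a\<^sup>2) * a * ((1 + m) * a * u + 1) / (S * (2 - S) * (a + \<kappa> * u))"
proof -
  have "0 < (1 + m) * a\<^sup>2" using pos by (intro mult_pos_pos) auto
  then have S2: "0 < 2 - S" using S by linarith
  have N: "0 < a + \<kappa> * u" unfolding \<kappa> using pos by (intro add_pos_nonneg) auto
  have \<kappa>': "\<kappa> * S = m * a\<^sup>2" using \<kappa> pos by simp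
  have k': "k * (S * (2 - S)) = a\<^sup>2 * ((1 + m) * S - m)" using k pos S2 by simp
  have "(S * (2 - S)) * (a + \<kappa> * u) - k * (S * (2 - S)) * (a - u)
      = (1 - a\<^sup>2) * a * ((1 + m) * a * u + 1)"
  proof -
    have "(S * (2 - S)) * (a + \<kappa> * u) = (2 - S) * (a * S + m * a\<^sup>2 * u)"
      using \<kappa>' by algebra
    then show ?thesis unfolding k' unfolding S by algebra
  qed
  moreover have "1 - k * ((a - u) / (a + \<kappa> * u))
      = ((S * (2 - S)) * (a + \<kappa> * u) - k * (S * (2 - S)) * (a - u)) / (S * (2 - S) * (a + \<kappa> * u))"
  proof -
    define M where "M = S * (2 - S)"
    define N where "N = a + \<kappa> * u"
    have "M \<noteq> 0" "N \<noteq> 0" using S2 pos N by (simp_all add: M_def N_def)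
    then show ?thesis unfolding M_def[symmetric] N_def[symmetric] by (simp add: field_simps)
  qed
  ultimately show ?thesis by simp
qed

text \<open>
  Up to constants \<open>x\<^sup>2\<close> is \<open>(a - u) ((1 + m) a u + 1)\<close> and \<open>w\<^sup>2\<close> is \<open>u (a + \<kappa> u)\<close>. In the square of
  the derivative of \<open>arcsin (sqrt t)\<close> the factors \<open>u\<close> and \<open>a - u\<close> cancel against \<open>t (1 - t)\<close>; what
  remains is a constant times \<open>1 - k t\<close>. The sign is negative because \<open>u\<close> increases.
\<close>

lemma amplitude_deriv:
  fixes u :: "real \<Rightarrow> real"
  assumes pos: "0 < a" "0 < m" "0 < S" "0 < \<gamma>"
    and S: "S = 1 - (1 + m) * a\<^sup>2"
    and \<kappa>: "\<kappa> = m * a\<^sup>2 / S"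
    and k: "k = a\<^sup>2 * ((1 + m) * S - m) / (S * (2 - S))"
    and \<omega>: "\<omega> = \<gamma> * sqrt (S * (2 - S)) / (2 * a)"
    and u: "0 < u \<tau>" "u \<tau> < a" and xw: "0 < x" "0 < w"
    and x: "x\<^sup>2 = 1 - S / a * u \<tau> - (1 + m) * (u \<tau>)\<^sup>2"
    and w: "w\<^sup>2 = S / a * u \<tau> + m * (u \<tau>)\<^sup>2"
    and du: "(u has_real_derivative \<gamma> * x * w) (at \<tau>)"
  shows "((\<lambda>\<tau>. arcsin (sqrt ((a - u \<tau>) / (a + \<kappa> * u \<tau>)))) has_real_derivative
      - \<omega> * sqrt (1 - k * ((a - u \<tau>) / (a + \<kappa> * u \<tau>)))) (at \<tau>)"
proof -
  define v where "v = u \<tau>"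
  define N where "N = a + \<kappa> * v"
  define t where "t = (a - v) / N"
  have v: "0 < v" "v < a" using u by (auto simp: v_def)
  have "0 < (1 + m) * a\<^sup>2" using pos by (intro mult_pos_pos) auto
  then have S2: "0 < 2 - S" using S by linarith
  have \<kappa>pos: "0 < \<kappa>" using \<kappa> pos by simp
  have N: "0 < N" unfolding N_def using pos v \<kappa>pos by (intro add_pos_pos) auto
  have \<kappa>1: "(1 + \<kappa>) * S = 1 - a\<^sup>2"
  proof -
    have "\<kappa> * S = m * a\<^sup>2" using \<kappa> pos by simp
    then show ?thesis using S by algebra
  qed
  have t: "0 < t" "1 - t = (1 + \<kappa>) * v / N"
    using N v by (auto simp: t_def field_simps N_def)
  have t1: "0 < 1 - t" unfolding t(2) using N v \<kappa>pos by simp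
  define D where "D = a * (1 + \<kappa>) * \<gamma> * x * w / N\<^sup>2 / (2 * sqrt t * sqrt (1 - t))"
  have deriv: "((\<lambda>\<tau>. arcsin (sqrt ((a - u \<tau>) / (a + \<kappa> * u \<tau>)))) has_real_derivative - D) (at \<tau>)"
  proof -
    have dt: "((\<lambda>\<tau>. (a - u \<tau>) / (a + \<kappa> * u \<tau>)) has_real_derivative
        - (a * (1 + \<kappa>) * \<gamma> * x * w / N\<^sup>2)) (at \<tau>)"
    proof (rule DERIV_cong)
      have "((\<lambda>\<tau>. a - u \<tau>) has_real_derivative - (\<gamma> * x * w)) (at \<tau>)"
        "((\<lambda>\<tau>. a + \<kappa> * u \<tau>) has_real_derivative \<kappa> * (\<gamma> * x * w)) (at \<tau>)"
        by (auto intro!: derivative_eq_intros du)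
      from DERIV_quotient[OF this]
      show "((\<lambda>\<tau>. (a - u \<tau>) / (a + \<kappa> * u \<tau>)) has_real_derivative
         (- (\<gamma> * x * w) * N - \<kappa> * (\<gamma> * x * w) * (a - v)) / N\<^sup>2) (at \<tau>)"
        using N by (simp add: N_def v_def numeral_2_eq_2)
      have "- (\<gamma> * x * w) * N - \<kappa> * (\<gamma> * x * w) * (a - v) = - (a * (1 + \<kappa>) * \<gamma> * x * w)"
        unfolding N_def by algebra
      then show "(- (\<gamma> * x * w) * N - \<kappa> * (\<gamma> * x * w) * (a - v)) / N\<^sup>2
          = - (a * (1 + \<kappa>) * \<gamma> * x * w / N\<^sup>2)" by simp
    qed
    have ds: "((\<lambda>\<tau>. sqrt ((a - u \<tau>) / (a + \<kappa> * u \<tau>))) has_real_derivative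
        - (a * (1 + \<kappa>) * \<gamma> * x * w / N\<^sup>2) / (2 * sqrt t)) (at \<tau>)"
      apply (rule DERIV_cong)
       apply (rule DERIV_chain2[OF DERIV_real_sqrt dt])
      using t(1) unfolding t_def N_def v_def by (simp_all add: field_simps)
    have "(arcsin has_real_derivative inverse (sqrt (1 - (sqrt t)\<^sup>2))) (at (sqrt t))"
    proof (rule DERIV_arcsin)
      show "-1 < sqrt t" using t(1) by (meson less_trans neg_less_0_iff_less real_sqrt_gt_0_iff zero_less_one)
      show "sqrt t < 1" using t1 by simp
    qed
    then have da: "(arcsin has_real_derivative inverse (sqrt (1 - t)))
        (at (sqrt ((a - u \<tau>) / (a + \<kappa> * u \<tau>))))"
      using t(1) by (simp add: t_def N_def v_def)
    show ?thesis
      by (rule DERIV_cong[OF DERIV_chain2[OF da ds]]) (simp add: D_def field_simps)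
  qed
  \<comment> \<open>comparing squares keeps the square roots out of the algebra\<close>
  have D0: "0 \<le> D"
    unfolding D_def using pos \<kappa>pos xw t(1) t1 by simp
  have "D\<^sup>2 = \<omega>\<^sup>2 * (1 - k * t)"
  proof -
    have xx: "x\<^sup>2 * a = (a - v) * ((1 + m) * a * v + 1)"
    proof -
      have "x\<^sup>2 * a = a - S * v - (1 + m) * v\<^sup>2 * a"
        unfolding x v_def[symmetric] using pos by (simp add: field_simps)
      then show ?thesis using S by algebra
    qed
    have ww: "w\<^sup>2 * a\<^sup>2 = S * v * N"
    proof -
      have "\<kappa> * S = m * a\<^sup>2" using \<kappa> pos by simp
      moreover have "w\<^sup>2 * a\<^sup>2 = a * S * v + a\<^sup>2 * m * v\<^sup>2"
        unfolding w v_def[symmetric] using pos by (simp add: field_simps power2_eq_square)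
      ultimately show ?thesis unfolding N_def by algebra
    qed
    have "D\<^sup>2 = (a * (1 + \<kappa>) * \<gamma> * x * w)\<^sup>2 / (N\<^sup>2)\<^sup>2 / (4 * (t * (1 - t)))"
      unfolding D_def using t(1) t1 by (simp only: power_divide power_mult_distrib) simp
    also have "\<dots> = a\<^sup>2 * (1 + \<kappa>)\<^sup>2 * \<gamma>\<^sup>2 * (x\<^sup>2 * w\<^sup>2) / N ^ 4 / (4 * (t * (1 - t)))"
      by (simp add: power_mult_distrib mult.assoc flip: power_mult)
    also have "t * (1 - t) = (a - v) * (1 + \<kappa>) * v / N\<^sup>2"
      unfolding t(2) by (simp add: t_def power2_eq_square)
    also have "x\<^sup>2 * w\<^sup>2 = (a - v) * ((1 + m) * a * v + 1) * (S * v * N) / a ^ 3"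
      unfolding xx[symmetric] ww[symmetric] using pos by (simp add: power2_eq_square power3_eq_cube)
    also have "a\<^sup>2 * (1 + \<kappa>)\<^sup>2 * \<gamma>\<^sup>2 * \<dots> / N ^ 4 / (4 * ((a - v) * (1 + \<kappa>) * v / N\<^sup>2))
        = \<gamma>\<^sup>2 * ((1 + \<kappa>) * S) * ((1 + m) * a * v + 1) / (4 * a * N)"
    proof -
      have nz: "a - v \<noteq> 0" "v \<noteq> 0" "1 + \<kappa> \<noteq> 0" "N \<noteq> 0" "a \<noteq> 0" using v \<kappa>pos N pos by auto
      define M where "M = (1 + m) * a * v + 1"
      define d where "d = a - v"
      define K where "K = 1 + \<kappa>"
      show ?thesis
        using nz unfolding M_def[symmetric] d_def[symmetric] K_def[symmetric]
        by (simp add: field_simps power2_eq_square power3_eq_cube power4_eq_xxxx)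
    qed
    also have "\<dots> = \<omega>\<^sup>2 * ((1 - a\<^sup>2) * a * ((1 + m) * a * v + 1) / (S * (2 - S) * N))"
    proof -
      have "\<omega>\<^sup>2 = \<gamma>\<^sup>2 * (S * (2 - S)) / (4 * a\<^sup>2)"
        unfolding \<omega> using pos S2 by (simp add: power_divide power_mult_distrib)
      moreover have "S * (2 - S) \<noteq> 0" using pos S2 by simp
      ultimately show ?thesis
        unfolding \<kappa>1 using pos N by (simp add: divide_simps power2_eq_square)
    qed
    finally show ?thesis
      using one_minus_k_amplitude[OF pos(1-3) less_imp_le[OF v(1)] S \<kappa> k]
      by (simp add: t_def N_def)
  qed
  then have "D = sqrt (\<omega>\<^sup>2 * (1 - k * t))" using D0 by (metis real_sqrt_unique)
  also have "\<dots> = \<omega> * sqrt (1 - k * t)"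
  proof -
    have "0 \<le> \<omega>" unfolding \<omega> using pos S2 by simp
    then show ?thesis by (simp add: real_sqrt_mult)
  qed
  finally show ?thesis using deriv by (simp add: t_def N_def v_def)
qed

text \<open>
  Here \<open>W\<close> stands for \<open>z\<^sup>2\<close>. The parameters \<open>p\<close> and \<open>q\<close> are chosen so that \<open>1 - p t\<close> vanishes at
  \<open>u = -1\<close> and \<open>1 - q t\<close> at \<open>u = 1\<close>, the two poles of the precession rate. Both factors have the
  denominator \<open>a + \<kappa> u\<close>, which supplies the factor of \<open>W\<close> that vanishes at \<open>t = \<infinity>\<close>; the weights \<open>a - 1\<close>
  and \<open>a + 1\<close> leave in the sum of the two fractions a numerator proportional to \<open>u\<close>, the other factor
  of \<open>W\<close>.
\<close>

lemma precession_partial_fractions: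
  fixes a m S u :: real
  assumes pos: "0 < a" "a < 1" "0 < m" "0 < S"
    and S: "S = 1 - (1 + m) * a\<^sup>2"
    and \<kappa>: "\<kappa> = m * a\<^sup>2 / S"
    and \<omega>: "\<omega> = \<gamma> * sqrt (S * (2 - S)) / (2 * a)"
    and g: "g = 1 / ((1 + m) * a * sqrt (S * (2 - S)))"
    and p: "p = 1 - (1 - a) / S" and q: "q = 1 - (1 + a) / S"
    and u: "0 < u" "u < a"
    and w: "W = S / a * u + m * u\<^sup>2"
    and t: "t = (a - u) / (a + \<kappa> * u)"
  shows "\<gamma> * W / (1 - u\<^sup>2) =
    \<omega> * (g * (1 + m) * a * (a - 1) / (1 - p * t) + g * (1 + m) * a * (a + 1) / (1 - q * t))"
proof -
  define N where "N = a + \<kappa> * u"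
  have "0 < (1 + m) * a\<^sup>2" using pos by (intro mult_pos_pos) auto
  then have "0 < 2 - S" using S by linarith
  then have S2: "0 < S * (2 - S)" using pos by simp
  have \<kappa>': "\<kappa> * S = m * a\<^sup>2" using \<kappa> pos by simp
  have \<kappa>0: "0 < \<kappa>" using \<kappa> pos by simp
  have N: "0 < N" unfolding N_def using pos u \<kappa>0 by (intro add_pos_pos) auto
  have \<omega>g: "\<omega> * (g * (1 + m) * a) = \<gamma> / (2 * a)"
  proof -
    define R where "R = sqrt (S * (2 - S))"
    have "0 < R" unfolding R_def by (rule real_sqrt_gt_zero[OF S2])
    then show ?thesis unfolding \<omega> g R_def[symmetric] using pos by simp
  qed
  have pt: "1 - p * t = (1 - a) * a * (1 + u) / (S * N)"
  proof -
    have "S * N - (S - (1 - a)) * (a - u) = (1 - a) * a * (1 + u)"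
      unfolding N_def using \<kappa>' S by algebra
    moreover have "1 - p * t = (S * N - (S - (1 - a)) * (a - u)) / (S * N)"
      unfolding p t N_def[symmetric] using pos N by (simp add: field_simps)
    ultimately show ?thesis by simp
  qed
  have qt: "1 - q * t = (1 + a) * a * (1 - u) / (S * N)"
  proof -
    have "S * N - (S - (1 + a)) * (a - u) = (1 + a) * a * (1 - u)"
      unfolding N_def using \<kappa>' S by algebra
    moreover have "1 - q * t = (S * N - (S - (1 + a)) * (a - u)) / (S * N)"
      unfolding q t N_def[symmetric] using pos N by (simp add: field_simps)
    ultimately show ?thesis by simp
  qed
  have W: "W = S * u * N / a\<^sup>2"
    unfolding w N_def \<kappa> using pos by (simp add: field_simps power2_eq_square)
  have "\<omega> * (g * (1 + m) * a * (a - 1) / (1 - p * t) + g * (1 + m) * a * (a + 1) / (1 - q * t))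
      = \<omega> * (g * (1 + m) * a) * ((a - 1) / (1 - p * t) + (a + 1) / (1 - q * t))"
    by (simp only: distrib_left times_divide_eq_right mult.assoc)
  also have "(a - 1) / (1 - p * t) = - (S * N / (a * (1 + u)))"
    unfolding pt using pos u N by (simp add: divide_simps) (simp add: left_diff_distrib right_diff_distrib)
  also have "(a + 1) / (1 - q * t) = S * N / (a * (1 - u))"
    unfolding qt using pos u N by (simp add: divide_simps)
  also have "\<omega> * (g * (1 + m) * a) * (- (S * N / (a * (1 + u))) + S * N / (a * (1 - u)))
      = \<gamma> * (S * u * N / a\<^sup>2) / (1 - u\<^sup>2)"
  proof -
    have f: "1 - u\<^sup>2 = (1 - u) * (1 + u)" by (simp add: power2_eq_square algebra_simps)
    have nz: "1 - u \<noteq> 0" "1 + u \<noteq> 0" "a \<noteq> 0" using u pos by auto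
    have "- (S * N / (a * (1 + u))) + S * N / (a * (1 - u)) = 2 * S * N * u / (a * ((1 - u) * (1 + u)))"
      using nz by (simp add: divide_simps) (simp add: algebra_simps)
    then show ?thesis unfolding \<omega>g f by (simp add: power2_eq_square mult_ac)
  qed
  finally show ?thesis unfolding W by simp
qed

section \<open>The change of the precession angle\<close>

theorem lemma12:
  fixes I1 I2 I3 h l :: real
    and \<delta> \<gamma> \<rho> \<nu> :: real
    and \<phi> \<theta> \<psi> :: "real \<Rightarrow> real"
    and \<phi>off \<theta>off \<psi>off :: "real \<Rightarrow> real"
    and T2hat \<phi>2 \<theta>min s k2 g np nm fp fm :: real
  assumes inertia: "0 < I3" "I3 < I1" "I1 < I2"
    and l_pos: "0 < l" and h_nz: "h \<noteq> 0"
    and \<delta>: "\<delta> = I1 / I2 - 1" and \<gamma>: "\<gamma> = I1 / I3 - 1"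
    and \<rho>: "\<rho> = h / l" and \<nu>: "\<nu> = \<delta> / \<gamma>"
    \<comment> \<open>rotor-on stage: from \<open>(l,0,0)\<close> until the tilt first takes its maximal value on the orbit\<close>
    and rotor_on: "scaled_motion \<delta> \<gamma> \<rho> \<phi> \<theta> \<psi>"
    and start: "body_ang_mom l (\<theta> 0) (\<psi> 0) = vector [l, 0, 0]"
    and T2hat_pos: "0 < T2hat"
    and max_tilt: "\<And>\<tau>. tilt l (\<theta> \<tau>) (\<psi> \<tau>) \<le> tilt l (\<theta> T2hat) (\<psi> T2hat)"
    and first_max: "\<And>\<tau>. 0 \<le> \<tau> \<Longrightarrow> \<tau> < T2hat \<Longrightarrow>
                      tilt l (\<theta> \<tau>) (\<psi> \<tau>) < tilt l (\<theta> T2hat) (\<psi> T2hat)"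
    and \<phi>2: "\<phi>2 = \<phi> T2hat - \<phi> 0"
    \<comment> \<open>subsequent rotor-off twisting motion and its minimal tilt\<close>
    and rotor_off: "scaled_motion \<delta> \<gamma> 0 \<phi>off \<theta>off \<psi>off"
    and switch: "\<phi>off T2hat = \<phi> T2hat" "\<theta>off T2hat = \<theta> T2hat" "\<psi>off T2hat = \<psi> T2hat"
    and min_tilt: "\<And>\<tau>. T2hat \<le> \<tau> \<Longrightarrow> \<theta>min \<le> tilt l (\<theta>off \<tau>) (\<psi>off \<tau>)"
    and min_attained: "\<exists>\<tau>\<ge>T2hat. tilt l (\<theta>off \<tau>) (\<psi>off \<tau>) = \<theta>min"
    and s: "s = sin \<theta>min"
    and k2: "k2 = (1 / s\<^sup>2 - 1) * (s\<^sup>2 * (1 - \<nu>) + \<nu>) / ((2 - s\<^sup>2) * (1 - \<nu>))"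
    \<comment> \<open>The source prints the reciprocal of this \<open>g\<close>, which makes the identity false: for
      \<open>(I1,I2,I3,h,l) = (1, 1.2, 0.3, 0.15, 1)\<close> the left-hand side is about 1.2594, which this
      \<open>g\<close> reproduces, while the printed one gives 0.2274.\<close>
    and g: "g = 1 / (s * sqrt ((1 - s\<^sup>2) * (2 - s\<^sup>2) * (1 - \<nu>)))"
    and np: "np = 1 - 1 / s\<^sup>2 + 1 / s\<^sup>2 * sqrt ((1 - s\<^sup>2) / (1 - \<nu>))"
    and nm: "nm = 1 - 1 / s\<^sup>2 - 1 / s\<^sup>2 * sqrt ((1 - s\<^sup>2) / (1 - \<nu>))"
    and fp: "fp = g * (1 - s\<^sup>2 - sqrt ((1 - s\<^sup>2) * (1 - \<nu>)))"
    and fm: "fm = g * (1 - s\<^sup>2 + sqrt ((1 - s\<^sup>2) * (1 - \<nu>)))"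
  shows "\<phi>2 - T2hat = fp * ellipticPi np k2 + fm * ellipticPi nm k2"
proof -
  define X where "X \<tau> = cos (\<theta> \<tau>) * cos (\<psi> \<tau>)" for \<tau>
  define Y where "Y \<tau> = - sin (\<theta> \<tau>)" for \<tau>
  define Z where "Z \<tau> = cos (\<theta> \<tau>) * sin (\<psi> \<tau>)" for \<tau>
  define \<sigma> where "\<sigma> = sgn \<rho>"
  define r where "r = (1 + \<delta>) * \<bar>\<rho>\<bar>"
  \<comment> \<open>negating \<open>y\<close>, \<open>z\<close> and \<open>\<rho>\<close> together preserves the equations, so \<open>\<sigma>\<close> absorbs the sign of the rotor
    momentum; the extra minus sign in \<open>w\<close> is there because \<open>z\<close> initially moves against \<open>\<rho>\<close>\<close>
  define u where "u \<tau> = \<sigma> * Y \<tau>" for \<tau>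
  define w where "w \<tau> = - \<sigma> * Z \<tau>" for \<tau>
  have \<gamma>0: "0 < \<gamma>" and \<delta>0: "\<delta> < 0" and \<delta>1: "0 < 1 + \<delta>"
    using inertia by (auto simp: \<gamma> \<delta>)
  have \<rho>0: "\<rho> \<noteq> 0" using \<rho> h_nz l_pos by simp
  then have r0: "0 < r" using \<delta>1 by (simp add: r_def)
  have \<sigma>2: "\<sigma> * \<sigma> = 1" using \<rho>0 by (simp add: \<sigma>_def sgn_if)
  have r\<sigma>: "r = \<sigma> * ((1 + \<delta>) * \<rho>)" by (simp add: r_def \<sigma>_def abs_sgn)
  have u2: "(u \<tau>)\<^sup>2 = (Y \<tau>)\<^sup>2" and w2: "(w \<tau>)\<^sup>2 = (Z \<tau>)\<^sup>2" for \<tau>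
    unfolding u_def w_def using \<sigma>2 by algebra+

  note d = ang_mom_deriv[OF rotor_on, folded X_def Y_def Z_def]
  have dX: "(X has_real_derivative - w \<tau> * (r + (\<gamma> - \<delta>) * u \<tau>)) (at \<tau>)" for \<tau>
  proof -
    have "Z \<tau> * ((1 + \<delta>) * \<rho> + (\<gamma> - \<delta>) * Y \<tau>) = - w \<tau> * (r + (\<gamma> - \<delta>) * u \<tau>)"
      unfolding w_def u_def r\<sigma> using \<sigma>2 by algebra
    then show ?thesis using d(1)[of \<tau>] by (simp add: X_def[abs_def] Y_def Z_def)
  qed
  have du: "(u has_real_derivative \<gamma> * X \<tau> * w \<tau>) (at \<tau>)" for \<tau>
    using DERIV_cmult[OF d(2)[of \<tau>], of \<sigma>]
    unfolding u_def[abs_def] w_def Y_def[abs_def] X_def Z_def by (simp add: mult_ac)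
  have dw: "(w has_real_derivative X \<tau> * (r - \<delta> * u \<tau>)) (at \<tau>)" for \<tau>
  proof -
    have "- \<sigma> * (X \<tau> * (- (1 + \<delta>) * \<rho> + \<delta> * Y \<tau>)) = X \<tau> * (r - \<delta> * u \<tau>)"
      unfolding u_def r\<sigma> by algebra
    then show ?thesis
      using DERIV_cmult[OF d(3)[of \<tau>], of "- \<sigma>"]
      unfolding w_def[abs_def] Z_def[abs_def] X_def Y_def by simp
  qed
  have sphere: "(X \<tau>)\<^sup>2 + (u \<tau>)\<^sup>2 + (w \<tau>)\<^sup>2 = 1" for \<tau>
    unfolding u2 w2 using ang_mom_unit[of "\<theta> \<tau>" "\<psi> \<tau>"] by (simp add: X_def Y_def Z_def)
  have "body_ang_mom l (\<theta> 0) (\<psi> 0) $ i = vector [l, 0, 0] $ i" for i :: 3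
    by (simp add: start)
  from this[of 1] this[of 2] this[of 3]
  have start': "X 0 = 1" "u 0 = 0" "w 0 = 0"
    using l_pos by (auto simp: body_ang_mom_def X_def Y_def Z_def u_def w_def)
  have max': "(w \<tau>)\<^sup>2 \<le> (w T2hat)\<^sup>2" for \<tau>
    using max_tilt[of \<tau>] by (simp add: w2 Z_def tilt_mono_iff[OF l_pos])
  have first': "(w \<tau>)\<^sup>2 < (w T2hat)\<^sup>2" if "0 \<le> \<tau>" "\<tau> < T2hat" for \<tau>
    using first_max[OF that] by (simp add: w2 Z_def tilt_mono_iff[OF l_pos] flip: not_le)
  note seg = rotor_on_segment[OF \<gamma>0 \<delta>0 r0 T2hat_pos dX du dw sphere start' max' first']
  note en = rotor_on_energy[of u \<gamma> X w r \<delta>, OF du dw start'(2,3)]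

  define a where "a = u T2hat"
  define m where "m = - \<nu>"
  define S where "S = 1 - (1 + m) * a\<^sup>2"
  have m0: "0 < m" unfolding m_def \<nu> using \<gamma>0 \<delta>0 by (simp add: divide_neg_pos)
  have m\<gamma>: "\<gamma> * m = - \<delta>" unfolding m_def \<nu> using \<gamma>0 by simp
  have a0: "0 < a" using seg(4)[of T2hat] T2hat_pos by (simp add: a_def)
  have wT: "(w T2hat)\<^sup>2 = 1 - a\<^sup>2" using sphere[of T2hat] seg(1) by (simp add: a_def)
  have "0 < (w T2hat)\<^sup>2" using seg(3)[of T2hat] T2hat_pos by simp
  then have "a\<^sup>2 < 1\<^sup>2" using wT by simp
  then have a1: "a < 1" by (rule power_less_imp_less_base) simp
  \<comment> \<open>the rotor strength \<open>r\<close> enters only through this relation, so \<open>a\<close> and \<open>S\<close> can replace it\<close>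
  have S\<gamma>: "\<gamma> * S = 2 * r * a"
    using en[of T2hat] wT m\<gamma> unfolding S_def a_def[symmetric] by algebra
  have S0: "0 < S" using S\<gamma> r0 a0 \<gamma>0 by (metis mult_pos_pos zero_less_mult_pos zero_less_numeral)
  have Sa: "2 * r / \<gamma> = S / a" using S\<gamma> a0 \<gamma>0 by (simp add: field_simps)
  have W: "(w \<tau>)\<^sup>2 = S / a * u \<tau> + m * (u \<tau>)\<^sup>2" for \<tau>
  proof -
    have "(w \<tau>)\<^sup>2 = 2 * r / \<gamma> * u \<tau> - \<delta> / \<gamma> * (u \<tau>)\<^sup>2"
      using en[of \<tau>] \<gamma>0 by (simp add: field_simps power2_eq_square)
    then show ?thesis unfolding Sa by (simp add: m_def \<nu>)
  qed
  have X2: "(X \<tau>)\<^sup>2 = 1 - S / a * u \<tau> - (1 + m) * (u \<tau>)\<^sup>2" for \<tau>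
    using sphere[of \<tau>] unfolding W by (simp add: algebra_simps)
  have u_less: "u \<tau> < a" if "0 < \<tau>" "\<tau> < T2hat" for \<tau>
  proof (rule ccontr)
    assume "\<not> u \<tau> < a"
    then have "S / a * a \<le> S / a * u \<tau>"
      by (intro mult_left_mono) (use a0 S0 in auto)
    moreover have "(1 + m) * a\<^sup>2 \<le> (1 + m) * (u \<tau>)\<^sup>2"
      using \<open>\<not> u \<tau> < a\<close> by (intro mult_left_mono power_mono) (use a0 m0 in auto)
    ultimately have "S \<le> S / a * u \<tau>" "(1 + m) * a\<^sup>2 \<le> (1 + m) * (u \<tau>)\<^sup>2" using a0 by simp_all
    then have "(X \<tau>)\<^sup>2 \<le> 0" unfolding X2 using a0 by (simp add: S_def)
    then show False using seg(2)[of \<tau>] that by simp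
  qed

  have s_eq: "0 < s" "s\<^sup>2 = S"
  proof -
    obtain \<tau>0 where \<tau>0: "T2hat \<le> \<tau>0" "\<theta>min = tilt l (\<theta>off \<tau>0) (\<psi>off \<tau>0)"
      using min_attained by auto
    note doff = ang_mom_deriv[OF rotor_off, simplified]
    have "\<gamma> * (cos (\<theta>off \<tau>0) * sin (\<psi>off \<tau>0))\<^sup>2
      = \<gamma> * (cos (\<theta>off T2hat) * sin (\<psi>off T2hat))\<^sup>2 + \<delta> * (- sin (\<theta>off T2hat))\<^sup>2"
    proof (rule twisting_min[where x = "\<lambda>\<tau>. cos (\<theta>off \<tau>) * cos (\<psi>off \<tau>)"
            and y = "\<lambda>\<tau>. - sin (\<theta>off \<tau>)" and z = "\<lambda>\<tau>. cos (\<theta>off \<tau>) * sin (\<psi>off \<tau>)",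
            OF \<gamma>0 \<delta>0 _ _ _ _ _ _ _ \<tau>0(1)])
      show "cos (\<theta>off T2hat) * cos (\<psi>off T2hat) = 0"
        using seg(1) by (simp add: switch X_def)
      show "- sin (\<theta>off T2hat) \<noteq> 0"
        using a0 by (auto simp: switch a_def u_def Y_def)
      have "\<gamma> * (w T2hat)\<^sup>2 + \<delta> * (u T2hat)\<^sup>2 = \<gamma> * S"
        using wT m\<gamma> unfolding S_def a_def[symmetric] by algebra
      then show "0 < \<gamma> * (cos (\<theta>off T2hat) * sin (\<psi>off T2hat))\<^sup>2 + \<delta> * (- sin (\<theta>off T2hat))\<^sup>2"
        using \<gamma>0 S0 unfolding u2 w2 by (simp add: switch Y_def Z_def)
    next
      fix \<tau> assume "T2hat \<le> \<tau>"
      then show "(cos (\<theta>off \<tau>0) * sin (\<psi>off \<tau>0))\<^sup>2 \<le> (cos (\<theta>off \<tau>) * sin (\<psi>off \<tau>))\<^sup>2"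
        using min_tilt[of \<tau>] \<tau>0(2) tilt_mono_iff[OF l_pos] by simp
    next
      fix \<tau>
      show "(cos (\<theta>off \<tau>) * cos (\<psi>off \<tau>))\<^sup>2 + (- sin (\<theta>off \<tau>))\<^sup>2
          + (cos (\<theta>off \<tau>) * sin (\<psi>off \<tau>))\<^sup>2 = 1"
        using ang_mom_unit by simp
    qed (use doff in \<open>auto simp: mult_ac\<close>)
    moreover have "s = \<bar>cos (\<theta>off \<tau>0) * sin (\<psi>off \<tau>0)\<bar>"
      unfolding s \<tau>0(2) by (rule sin_tilt[OF l_pos])
    ultimately have "\<gamma> * s\<^sup>2 = \<gamma> * (w T2hat)\<^sup>2 + \<delta> * (u T2hat)\<^sup>2" and s0: "0 \<le> s"
      unfolding u2 w2 by (simp_all add: switch Y_def Z_def)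
    then have "\<gamma> * s\<^sup>2 = \<gamma> * S"
      using wT m\<gamma> unfolding S_def a_def[symmetric] by algebra
    then show "s\<^sup>2 = S" using \<gamma>0 by simp
    then show "0 < s" using S0 s0 by (cases "s = 0") auto
  qed

  have am: "0 < (1 + m) * a" using a0 m0 by simp
  have S1: "1 - s\<^sup>2 = (1 + m) * a\<^sup>2" by (simp add: s_eq S_def)
  have "0 < (1 + m) * a * a" using am a0 by (rule mult_pos_pos)
  then have S2: "0 < 2 - S" by (simp add: S_def power2_eq_square mult.assoc)
  have ratio: "sqrt ((1 - s\<^sup>2) / (1 - \<nu>)) = a"
  proof -
    have "(1 - s\<^sup>2) / (1 - \<nu>) = a\<^sup>2" unfolding S1 using m0 by (simp add: m_def)
    then show ?thesis using a0 by simp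
  qed
  have product: "sqrt ((1 - s\<^sup>2) * (1 - \<nu>)) = (1 + m) * a"
    unfolding S1 by (rule real_sqrt_unique) (use am in \<open>auto simp: m_def power2_eq_square\<close>)
  have g': "g = 1 / ((1 + m) * a * sqrt (S * (2 - S)))"
  proof -
    have "s * sqrt ((1 - s\<^sup>2) * (2 - s\<^sup>2) * (1 - \<nu>))
        = s * (sqrt ((1 - s\<^sup>2) * (1 - \<nu>)) * sqrt (2 - s\<^sup>2))"
      by (simp add: real_sqrt_mult mult_ac)
    also have "\<dots> = (1 + m) * a * (sqrt (s\<^sup>2) * sqrt (2 - s\<^sup>2))"
      unfolding product using s_eq(1) by simp
    finally show ?thesis unfolding g s_eq(2) by (simp add: real_sqrt_mult)
  qed
  have np': "np = 1 - (1 - a) / S" and nm': "nm = 1 - (1 + a) / S"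
    unfolding np nm ratio unfolding s_eq(2) using S0 by (simp_all add: field_simps)
  have fp': "fp = g * (1 + m) * a * (a - 1)" and fm': "fm = g * (1 + m) * a * (a + 1)"
    unfolding fp fm product unfolding S1 by (simp_all add: algebra_simps power2_eq_square)
  have k': "k2 = a\<^sup>2 * ((1 + m) * S - m) / (S * (2 - S))"
  proof -
    have *: "1 / S - 1 = (1 + m) * a\<^sup>2 / S"
      using S0 S1 by (simp add: field_simps s_eq(2))
    have **: "1 - \<nu> = 1 + m" "S * (1 + m) + \<nu> = (1 + m) * S - m"
      by (simp_all add: m_def)
    show ?thesis
      unfolding k2 s_eq(2) * ** using m0 by simp
  qed

  define \<kappa> where "\<kappa> = m * a\<^sup>2 / S"
  define \<omega> where "\<omega> = \<gamma> * sqrt (S * (2 - S)) / (2 * a)"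
  define t where "t \<tau> = (a - u \<tau>) / (a + \<kappa> * u \<tau>)" for \<tau>
  have \<kappa>0: "0 < \<kappa>" using m0 a0 S0 by (simp add: \<kappa>_def)
  have u_range: "0 \<le> u \<tau> \<and> u \<tau> \<le> a" if "0 \<le> \<tau>" "\<tau> \<le> T2hat" for \<tau>
  proof -
    from that consider "\<tau> = 0" | "\<tau> = T2hat" | "0 < \<tau>" "\<tau> < T2hat" by linarith
    then show ?thesis
      using seg(4)[of \<tau>] u_less[of \<tau>] start' a0 by cases (auto simp: a_def)
  qed
  have N0: "0 < a + \<kappa> * u \<tau>" if "0 \<le> \<tau>" "\<tau> \<le> T2hat" for \<tau>
    using u_range[OF that] a0 \<kappa>0 by (simp add: add_pos_nonneg)
  have t_range: "0 \<le> t \<tau> \<and> t \<tau> \<le> 1" if "0 \<le> \<tau>" "\<tau> \<le> T2hat" for \<tau>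
    unfolding t_def using N0[OF that] u_range[OF that] \<kappa>0
    by (auto simp: divide_le_eq intro: order_trans[of _ 0])
  have sin_sq: "(sin (arcsin (sqrt (t \<tau>))))\<^sup>2 = t \<tau>" if "0 \<le> \<tau>" "\<tau> \<le> T2hat" for \<tau>
  proof -
    have "-1 \<le> sqrt (t \<tau>)" "sqrt (t \<tau>) \<le> 1"
      using t_range[OF that] by (auto intro: order_trans[of _ 0])
    then show ?thesis using t_range[OF that] by simp
  qed
  have lt1: "np < 1" "nm < 1" "k2 < 1"
  proof -
    show "np < 1" "nm < 1" using np' nm' a0 a1 S0 by simp_all
    have "1 - k2 = (1 - a\<^sup>2) / (S * (2 - S))"
      using one_minus_k_amplitude[OF a0 m0 S0 order_refl S_def \<kappa>_def k'] a0 by simp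
    moreover have "0 < (1 - a\<^sup>2) / (S * (2 - S))" using \<open>a\<^sup>2 < 1\<^sup>2\<close> S0 S2 by simp
    ultimately show "k2 < 1" by simp
  qed
  have cont_u: "continuous_on {0..T2hat} u"
    using du by (meson DERIV_isCont continuous_at_imp_continuous_on)
  have d\<phi>: "(\<phi> has_real_derivative 1 + \<gamma> * (sin (\<psi> \<tau>))\<^sup>2) (at \<tau>)" for \<tau>
    using rotor_on by (auto simp: scaled_motion_def)
  have "(\<phi> T2hat - T2hat) - (\<phi> 0 - 0) = fp * ellipticPi np k2 + fm * ellipticPi nm k2"
  proof (rule elliptic_quadrature[where \<alpha> = "\<lambda>\<tau>. arcsin (sqrt (t \<tau>))" and \<omega> = \<omega>, OF T2hat_pos lt1])
    show "continuous_on {0..T2hat} (\<lambda>\<tau>. arcsin (sqrt (t \<tau>)))"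
    proof (rule continuous_on_arcsin)
      show "continuous_on {0..T2hat} (\<lambda>\<tau>. sqrt (t \<tau>))"
        unfolding t_def by (intro continuous_intros cont_u) (use N0 in force)
      show "\<forall>\<tau>\<in>{0..T2hat}. - 1 \<le> sqrt (t \<tau>) \<and> sqrt (t \<tau>) \<le> 1"
        using t_range by (auto intro: order_trans[of _ 0])
    qed
    show "continuous_on {0..T2hat} (\<lambda>\<tau>. \<phi> \<tau> - \<tau>)"
      using d\<phi> by (intro continuous_intros) (meson DERIV_isCont continuous_at_imp_continuous_on)
    show "arcsin (sqrt (t 0)) = pi / 2" "arcsin (sqrt (t T2hat)) = 0"
      using a0 by (simp_all add: t_def start' a_def)
  next
    fix \<tau> assume \<tau>: "0 < \<tau>" "\<tau> < T2hat"
    have u: "0 < u \<tau>" "u \<tau> < a" using seg(4)[of \<tau>] u_less[of \<tau>] \<tau> by auto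
    have sq: "(sin (arcsin (sqrt (t \<tau>))))\<^sup>2 = t \<tau>" using sin_sq[of \<tau>] \<tau> by simp
    have N: "0 < a + \<kappa> * u \<tau>" using N0[of \<tau>] \<tau> by simp
    have t01: "0 < t \<tau>" "t \<tau> < 1"
      unfolding t_def using N u \<kappa>0 by (auto simp: divide_less_eq intro: less_trans[of _ 0])
    show "0 < arcsin (sqrt (t \<tau>)) \<and> arcsin (sqrt (t \<tau>)) < pi / 2"
      using arcsin_less_arcsin[of 0 "sqrt (t \<tau>)"] arcsin_less_arcsin[of "sqrt (t \<tau>)" 1] t01
        order_trans[of "-1" 0 "sqrt (t \<tau>)"]
      by auto
    show "((\<lambda>\<tau>. arcsin (sqrt (t \<tau>))) has_real_derivative
        - \<omega> * sqrt (1 - k2 * (sin (arcsin (sqrt (t \<tau>))))\<^sup>2)) (at \<tau>)"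
      unfolding sq unfolding t_def
      using seg(2,3)[of \<tau>] \<tau> X2 W
      by (intro amplitude_deriv[OF a0 m0 S0 \<gamma>0 S_def \<kappa>_def k' \<omega>_def u _ _ _ _ du]) auto
    have prec: "\<gamma> * (sin (\<psi> \<tau>))\<^sup>2 = \<gamma> * (w \<tau>)\<^sup>2 / (1 - (u \<tau>)\<^sup>2)"
    proof -
      have "u \<tau> < 1" using u a1 by simp
      then have "(u \<tau>)\<^sup>2 < 1" using u(1) by (simp add: power_less_one_iff)
      moreover have "1 - (u \<tau>)\<^sup>2 = (cos (\<theta> \<tau>))\<^sup>2"
        unfolding u2 Y_def by (simp add: cos_squared_eq)
      moreover have "(w \<tau>)\<^sup>2 = (cos (\<theta> \<tau>))\<^sup>2 * (sin (\<psi> \<tau>))\<^sup>2"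
        unfolding w2 Z_def by (simp add: power_mult_distrib)
      ultimately show ?thesis by auto
    qed
    have "((\<lambda>\<tau>. \<phi> \<tau> - \<tau>) has_real_derivative \<gamma> * (sin (\<psi> \<tau>))\<^sup>2) (at \<tau>)"
      using DERIV_diff[OF d\<phi>[of \<tau>] DERIV_ident] by simp
    then show "((\<lambda>\<tau>. \<phi> \<tau> - \<tau>) has_real_derivative
        \<omega> * (fp / (1 - np * (sin (arcsin (sqrt (t \<tau>))))\<^sup>2) +
             fm / (1 - nm * (sin (arcsin (sqrt (t \<tau>))))\<^sup>2))) (at \<tau>)"
      unfolding sq prec fp' fm'
        precession_partial_fractions[OF a0 a1 m0 S0 S_def \<kappa>_def \<omega>_def g' np' nm' u W t_def] .
  qed
  then show ?thesis by (simp add: \<phi>2)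
qed

end
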